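(* Let $(X,G,\Phi)$ be an equicontinuous Cantor minimal system, let $x\in X$, and let $\overline{\Phi(G)}_x$ be the isotropy group of $x$ in $\overline{\Phi(G)}$. Then $$\bigcap_{k\in G}k\;\overline{\Phi(G)}_x\;k^{-1}$$ is the trivial group (where $k\in G$ acts by conjugation through $\Phi(k)\in\overline{\Phi(G)}$), and thus the maximal subgroup of $\overline{\Phi(G)}_x$ which is normal in $\overline{\Phi(G)}$ is also the trivial group.
   Context: An equicontinuous Cantor minimal system $(X,G,\Phi)$ consists of a Cantor set $X$, a finitely generated infinite group $G$, and an action $\Phi\colon G\times X\to X$ by homeomorphisms (write $g\cdot x=\Phi(g)(x)$) which is minimal (every orbit is dense) and equicontinuous: for a metric $d$ on $X$, for all $\varepsilon>0$ there is $\delta>0$ such that $d(u,v)<\delta$ implies $d(g\cdot u,g\cdot v)<\varepsilon$ for all $u,v\in X$, $g\in G$. $\overline{\Phi(G)}$ is the closure of $\Phi(G)\subset \mathrm{Homeo}(X)$ in the uniform topology; it is a compact topological group acting transitively on $X$. Its isotropy group at $x$ is $\overline{\Phi(G)}_x=\{\hat g\in\overline{\Phi(G)}\mid\hat g(x)=x\}$. *)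

theory Defs
  imports
    "HOL-Analysis.Analysis"
    "HOL-Algebra.Group_Action"
    "HOL-Algebra.Generated_Groups"
begin

definition cantor_space :: "'a topology \<Rightarrow> bool" where
  "cantor_space X \<longleftrightarrow>
     X homeomorphic_space product_topology (\<lambda>_::nat. discrete_topology (UNIV :: bool set)) UNIV"

(* As in BijGroup, maps of X are represented by functions that are extensional on topspace X. *)
definition Homeo :: "'a topology \<Rightarrow> ('a \<Rightarrow> 'a) monoid" where
  "Homeo X = BijGroup (topspace X)
     \<lparr>carrier := {f \<in> Bij (topspace X). homeomorphic_map X X f}\<rparr>"

definition finitely_generated :: "('g, 'b) monoid_scheme \<Rightarrow> bool" where
  "finitely_generated G \<longleftrightarrow> (\<exists>S. finite S \<and> S \<subseteq> carrier G \<and> generate G S = carrier G)"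

(* The space X is the carrier of the metric m, with the metric topology. *)
locale equicontinuous_cantor_minimal_system = group G
  for m :: "'a metric" and G :: "('g, 'b) monoid_scheme" (structure)
    and \<phi> :: "'g \<Rightarrow> 'a \<Rightarrow> 'a" +
  assumes cantor: "cantor_space (mtopology_of m)"
    and finitely_generated: "finitely_generated G"
    and infinite: "infinite (carrier G)"
    and action: "\<phi> \<in> hom G (Homeo (mtopology_of m))"
    and minimal: "\<And>u. u \<in> mspace m \<Longrightarrow> mtopology_of m closure_of orbit G \<phi> u = mspace m"
    and equicontinuous:
      "\<And>\<epsilon>. \<epsilon> > 0 \<Longrightarrow> \<exists>\<delta>>0. \<forall>u\<in>mspace m. \<forall>v\<in>mspace m. \<forall>g\<in>carrier G.
         mdist m u v < \<delta> \<longrightarrow> mdist m (\<phi> g u) (\<phi> g v) < \<epsilon>"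

(* cfunspace carries the supremum metric. *)
definition uniform_topology :: "'a metric \<Rightarrow> ('a \<Rightarrow> 'a) topology" where
  "uniform_topology m =
     mtopology_of (submetric (cfunspace (mtopology_of m) m) (carrier (Homeo (mtopology_of m))))"

definition closure_group ::
  "'a metric \<Rightarrow> ('g, 'b) monoid_scheme \<Rightarrow> ('g \<Rightarrow> 'a \<Rightarrow> 'a) \<Rightarrow> ('a \<Rightarrow> 'a) monoid" where
  "closure_group m G \<phi> = Homeo (mtopology_of m)
     \<lparr>carrier := uniform_topology m closure_of (\<phi> ` carrier G)\<rparr>"

definition isotropy ::
  "'a metric \<Rightarrow> ('g, 'b) monoid_scheme \<Rightarrow> ('g \<Rightarrow> 'a \<Rightarrow> 'a) \<Rightarrow> 'a \<Rightarrow> ('a \<Rightarrow> 'a) set" where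
  "isotropy m G \<phi> x = {f \<in> carrier (closure_group m G \<phi>). f x = x}"

definition is_maximal_normal_subgroup_in ::
  "'c set \<Rightarrow> 'c set \<Rightarrow> ('c, 'd) monoid_scheme \<Rightarrow> bool" where
  "is_maximal_normal_subgroup_in N H E \<longleftrightarrow>
     subgroup N (E\<lparr>carrier := H\<rparr>) \<and> N \<lhd> E \<and>
     (\<forall>N'. subgroup N' (E\<lparr>carrier := H\<rparr>) \<and> N' \<lhd> E \<longrightarrow> N' \<subseteq> N)"

end

theory Submission
  imports Defs
begin

text \<open>
  An element of the intersection fixes every point \<open>\<phi> k x\<close>, hence a dense orbit, hence everything.
  A subgroup of the isotropy group that is normal in the closure lies in every conjugate of the
  isotropy group, so it is trivial as well. That the closure is a group needs no compactness
  argument on homeomorphisms: uniform limits of \<open>\<phi> g\<close> inherit the modulus of equicontinuity, which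
  gives products, and substituting \<open>y = f z\<close> in \<open>d (\<phi> (inv g) y, f\<^sup>-\<^sup>1 y)\<close> gives inverses.
\<close>

text \<open>A homeomorphism comes with some continuous inverse \<open>g\<close>. Injectivity forces
  \<open>g\<close> to agree on the space with \<open>inv_into\<close>, the inverse on which
  inversion in \<open>BijGroup\<close> is built.\<close>

lemma inv_into_homeomorphic_map:
  assumes "homeomorphic_map X X f"
  shows "homeomorphic_map X X (inv_into (topspace X) f)"
proof -
  obtain g where g: "homeomorphic_maps X X f g"
    using assms homeomorphic_map_maps by blast
  then have "homeomorphic_map X X g"
    using homeomorphic_maps_map by blast
  moreover have "g y = inv_into (topspace X) f y" if y: "y \<in> topspace X" for y
  proof -
    have "inj_on f (topspace X)"
      using assms by (simp add: homeomorphic_map_def)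
    moreover have "g y \<in> topspace X" "f (g y) = y"
      using g y by (auto simp: homeomorphic_maps_def continuous_map_def)
    ultimately show ?thesis
      by (metis inv_into_f_f)
  qed
  ultimately show ?thesis
    by (rule homeomorphic_map_eq)
qed

section \<open>The action and its uniform closure in pointwise terms\<close>

context equicontinuous_cantor_minimal_system
begin

sublocale ms: Metric_space "mspace m" "mdist m"
  by (rule Metric_space_mspace_mdist)

abbreviation "M \<equiv> mspace m"
abbreviation "E \<equiv> closure_group m G \<phi>"
abbreviation "B \<equiv> BijGroup (mspace m)"

text \<open>The Cantor cube is compact by Tychonoff. Compactness makes continuous self-maps bounded,
  so the homeomorphisms lie in the function space that carries the supremum metric.\<close>

lemma compactin_mspace: "compactin (mtopology_of m) (topspace (mtopology_of m))"
proof -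
  have "compact_space (product_topology (\<lambda>_::nat. discrete_topology (UNIV :: bool set)) UNIV)"
    by (simp add: compact_space_product_topology compact_space_discrete_topology)
  then show ?thesis
    using cantor homeomorphic_compact_space unfolding cantor_space_def compact_space_def by blast
qed

text \<open>\<open>Homeo\<close> borrows its operations from \<open>BijGroup\<close>, so the full
  group of bijections can serve as the target and \<open>Homeo\<close> itself need not be shown to
  be a group.\<close>

lemma group_hom_Bij: "group_hom G B \<phi>"
  using action group_BijGroup is_group
  by (auto simp: Homeo_def hom_def BijGroup_def group_hom_def group_hom_axioms_def)

lemma act_homeo:
  assumes "g \<in> carrier G"
  shows "\<phi> g \<in> Bij M" "homeomorphic_map (mtopology_of m) (mtopology_of m) (\<phi> g)"
  using action assms by (auto simp: Homeo_def hom_def)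

lemma act_closed: "\<phi> g u \<in> M" if "g \<in> carrier G" "u \<in> M"
  using act_homeo(1)[OF that(1)] that(2) Bij_imp_funcset by blast

lemma mult_B: "f \<otimes>\<^bsub>B\<^esub> h = compose M f h" if "f \<in> Bij M" "h \<in> Bij M"
  using that by (simp add: BijGroup_def)

lemma act_mult: "\<phi> (g \<otimes> h) u = \<phi> g (\<phi> h u)"
  if "g \<in> carrier G" "h \<in> carrier G" "u \<in> M"
  using that by (simp add: group_hom.hom_mult[OF group_hom_Bij] mult_B act_homeo compose_eq)

lemma act_one: "\<phi> \<one> u = u" if "u \<in> M"
  using that group_hom.hom_one[OF group_hom_Bij] by (simp add: BijGroup_def)

lemma act_inv: "\<phi> (inv g) (\<phi> g u) = u" if "g \<in> carrier G" "u \<in> M"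
  using act_mult[of "inv g" g u] that by (simp add: act_one)

text \<open>Replaces the supremum metric by uniform pointwise estimates; the arguments about the
  closure below work from this form alone.\<close>

lemma mem_closure_iff:
  "f \<in> carrier E \<longleftrightarrow>
     (f \<in> Bij M \<and> homeomorphic_map (mtopology_of m) (mtopology_of m) f) \<and>
     (\<forall>\<epsilon>>0. \<exists>g\<in>carrier G. \<forall>u\<in>M. mdist m (f u) (\<phi> g u) < \<epsilon>)"
    (is "_ \<longleftrightarrow> ?homeo f \<and> ?lim f")
proof -
  let ?C = "cfunspace (mtopology_of m) m"
  let ?S = "submetric ?C (carrier (Homeo (mtopology_of m)))"
  have homeo_C: "f \<in> mspace ?C" if "?homeo f" for f
    using that Bij_imp_funcset[of f M] Bij_imp_extensional[of f M] homeomorphic_imp_continuous_map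
    unfolding compactin_mspace_cfunspace[OF compactin_mspace]
    by auto
  then have S: "f \<in> mspace ?S \<longleftrightarrow> ?homeo f" for f
    by (auto simp: Homeo_def)
  have "f \<in> carrier E \<longleftrightarrow>
      ?homeo f \<and> (\<forall>\<epsilon>>0. \<exists>g\<in>carrier G. mdist ?C f (\<phi> g) < \<epsilon>)"
  proof -
    interpret S: Metric_space "mspace ?S" "mdist ?S"
      by (rule Metric_space_mspace_mdist)
    have "uniform_topology m = S.mtopology"
      by (simp only: uniform_topology_def mtopology_of_def)
    then have "f \<in> carrier E \<longleftrightarrow>
        ?homeo f \<and> (\<forall>\<epsilon>>0. \<exists>g\<in>carrier G. \<phi> g \<in> mspace ?S \<and> mdist ?S f (\<phi> g) < \<epsilon>)"
      by (auto simp: closure_group_def S.metric_closure_of S.in_mball S simp del: mspace_submetric mdist_submetric)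
    then show ?thesis
      using act_homeo by (auto simp: S simp del: mspace_submetric)
  qed
  moreover have "(\<forall>\<epsilon>>0. \<exists>g\<in>carrier G. mdist ?C f (\<phi> g) < \<epsilon>) \<longleftrightarrow> ?lim f" if f: "?homeo f"
  proof (intro iffI allI impI)
    fix \<epsilon> :: real
    assume "\<epsilon> > 0" "\<forall>\<epsilon>>0. \<exists>g\<in>carrier G. mdist ?C f (\<phi> g) < \<epsilon>"
    then obtain g where g: "g \<in> carrier G" "mdist ?C f (\<phi> g) < \<epsilon>"
      by blast
    then have "\<forall>u\<in>M. mdist m (f u) (\<phi> g u) < \<epsilon>"
      using cfunspace_mdist_lt[OF compactin_mspace homeo_C[OF f] homeo_C] act_homeo by simp
    with g show "\<exists>g\<in>carrier G. \<forall>u\<in>M. mdist m (f u) (\<phi> g u) < \<epsilon>"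
      by blast
  next
    fix \<epsilon> :: real
    assume \<epsilon>: "\<epsilon> > 0" and "?lim f"
    \<comment> \<open>Strict pointwise bounds give only a weak bound on the supremum, hence the
      half.\<close>
    then obtain g where g: "g \<in> carrier G" "\<forall>u\<in>M. mdist m (f u) (\<phi> g u) < \<epsilon> / 2"
      by (meson half_gt_zero)
    then have "mdist ?C f (\<phi> g) \<le> \<epsilon> / 2"
      using \<epsilon> by (intro mdist_cfunspace_le) (auto intro: less_imp_le)
    with g \<epsilon> show "\<exists>g\<in>carrier G. mdist ?C f (\<phi> g) < \<epsilon>"
      by (intro bexI[of _ g]) auto
  qed
  ultimately show ?thesis
    by blast
qed

section \<open>The closure is a group\<close>

lemma act_in_closure: "\<phi> g \<in> carrier E" if "g \<in> carrier G"
  using that act_homeo act_closed by (auto simp: mem_closure_iff intro!: bexI[of _ g])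

text \<open>If \<open>a\<close> approximates \<open>f\<close> and \<open>b\<close> approximates
  \<open>h\<close>, then \<open>a \<otimes> b\<close> approximates the composite. The intermediate
  point is \<open>\<phi> a (h u)\<close>: replacing \<open>f\<close> by \<open>\<phi> a\<close>
  costs little at \<open>h u\<close>, and replacing \<open>h u\<close> by \<open>\<phi> b u\<close>
  under \<open>\<phi> a\<close> is controlled by equicontinuity.\<close>

lemma closure_compose:
  assumes f: "f \<in> carrier E" and h: "h \<in> carrier E"
  shows "compose M f h \<in> carrier E"
  unfolding mem_closure_iff
proof (intro conjI allI impI)
  have fB: "f \<in> Bij M" and hB: "h \<in> Bij M"
    using f h mem_closure_iff by auto
  then show "compose M f h \<in> Bij M"
    by (rule compose_Bij)
  have "homeomorphic_map (mtopology_of m) (mtopology_of m) (f \<circ> h)"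
    using f h mem_closure_iff homeomorphic_map_compose by blast
  then show "homeomorphic_map (mtopology_of m) (mtopology_of m) (compose M f h)"
    by (rule homeomorphic_map_eq) (simp add: compose_eq)
  fix \<epsilon> :: real
  assume \<epsilon>: "\<epsilon> > 0"
  then obtain \<delta> where \<delta>: "\<delta> > 0"
    "\<And>u v g. \<lbrakk>u \<in> M; v \<in> M; g \<in> carrier G; mdist m u v < \<delta>\<rbrakk> \<Longrightarrow> mdist m (\<phi> g u) (\<phi> g v) < \<epsilon>/2"
    using equicontinuous[of "\<epsilon>/2"] by (meson half_gt_zero)
  obtain a where a: "a \<in> carrier G" "\<And>u. u \<in> M \<Longrightarrow> mdist m (f u) (\<phi> a u) < \<epsilon>/2"
    using f \<epsilon> unfolding mem_closure_iff by (meson half_gt_zero)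
  obtain b where b: "b \<in> carrier G" "\<And>u. u \<in> M \<Longrightarrow> mdist m (h u) (\<phi> b u) < \<delta>"
    using h \<delta>(1) unfolding mem_closure_iff by meson
  have "mdist m (compose M f h u) (\<phi> (a \<otimes> b) u) < \<epsilon>" if u: "u \<in> M" for u
  proof -
    have M: "h u \<in> M" "f (h u) \<in> M" "\<phi> b u \<in> M"
      using u fB hB Bij_imp_funcset act_closed b by blast+
    then have "mdist m (f (h u)) (\<phi> a (\<phi> b u))
        \<le> mdist m (f (h u)) (\<phi> a (h u)) + mdist m (\<phi> a (h u)) (\<phi> a (\<phi> b u))"
      using a(1) act_closed by (intro ms.triangle) auto
    also have "\<dots> < \<epsilon>/2 + \<epsilon>/2"
      using a b \<delta>(2) M u by (intro add_strict_mono) auto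
    finally show ?thesis
      using u a b by (simp add: act_mult compose_eq)
  qed
  then show "\<exists>g\<in>carrier G. \<forall>u\<in>M. mdist m (compose M f h u) (\<phi> g u) < \<epsilon>"
    using a b by blast
qed

lemma closure_inverse:
  assumes f: "f \<in> carrier E"
  shows "restrict (inv_into M f) M \<in> carrier E"
  unfolding mem_closure_iff
proof (intro conjI allI impI)
  have fB: "f \<in> Bij M"
    using f mem_closure_iff by auto
  then show "restrict (inv_into M f) M \<in> Bij M"
    by (rule restrict_inv_into_Bij)
  have "homeomorphic_map (mtopology_of m) (mtopology_of m) (inv_into M f)"
    using inv_into_homeomorphic_map[of "mtopology_of m" f] f mem_closure_iff by simp
  then show "homeomorphic_map (mtopology_of m) (mtopology_of m) (restrict (inv_into M f) M)"
    by (rule homeomorphic_map_eq) simp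
  fix \<epsilon> :: real
  assume \<epsilon>: "\<epsilon> > 0"
  \<comment> \<open>The bound \<delta> is fixed before \<open>a\<close> is known; since it holds for
    all group elements at once, it applies to \<open>inv a\<close> later.\<close>
  then obtain \<delta> where \<delta>: "\<delta> > 0"
    "\<And>u v g. \<lbrakk>u \<in> M; v \<in> M; g \<in> carrier G; mdist m u v < \<delta>\<rbrakk> \<Longrightarrow> mdist m (\<phi> g u) (\<phi> g v) < \<epsilon>"
    using equicontinuous[of \<epsilon>] by meson
  obtain a where a: "a \<in> carrier G" "\<And>u. u \<in> M \<Longrightarrow> mdist m (f u) (\<phi> a u) < \<delta>"
    using f \<delta>(1) unfolding mem_closure_iff by meson
  have "mdist m (restrict (inv_into M f) M y) (\<phi> (inv a) y) < \<epsilon>" if y: "y \<in> M" for y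
  proof -
    \<comment> \<open>Since \<open>z\<close> equals \<open>\<phi> (inv a) (\<phi> a z)\<close>, the
      distance to estimate is that between the images of \<open>\<phi> a z\<close> and
      \<open>f z\<close> under one map \<open>\<phi> (inv a)\<close>, and these two points are
      \<delta>-close.\<close>
    define z where "z = inv_into M f y"
    have z: "z \<in> M" "f z = y"
      using fB y Bij_inv_into_mem[OF fB y] unfolding z_def Bij_def bij_betw_def
      by (auto simp: f_inv_into_f)
    have "mdist m (\<phi> (inv a) (\<phi> a z)) (\<phi> (inv a) y) < \<epsilon>"
      using \<delta>(2)[of "\<phi> a z" y "inv a"] a(1) a(2)[OF z(1)] z y act_closed
      by (simp add: ms.commute)
    then show ?thesis
      using y z a by (simp add: act_inv flip: z_def)
  qed
  then show "\<exists>g\<in>carrier G. \<forall>u\<in>M. mdist m (restrict (inv_into M f) M u) (\<phi> g u) < \<epsilon>"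
    using a by blast
qed

text \<open>Exposes the operations of \<open>E\<close> as those of \<open>B\<close>, from which the
  group laws are inherited.\<close>

lemma closure_group_eq: "E = B\<lparr>carrier := carrier E\<rparr>"
  by (simp add: closure_group_def Homeo_def)

lemma subgroup_closure: "subgroup (carrier E) B"
proof (rule group.subgroupI[OF group_BijGroup])
  show "carrier E \<subseteq> carrier B"
    by (auto simp: mem_closure_iff BijGroup_def)
  show "carrier E \<noteq> {}"
    using act_in_closure by blast
  fix f h
  assume fh: "f \<in> carrier E" "h \<in> carrier E"
  then show "inv\<^bsub>B\<^esub> f \<in> carrier E"
    using closure_inverse mem_closure_iff by (simp add: inv_BijGroup)
  show "f \<otimes>\<^bsub>B\<^esub> h \<in> carrier E"
    using fh closure_compose by (simp add: mult_B mem_closure_iff)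
qed

lemma group_closure: "group E"
  using group.subgroup_imp_group[OF group_BijGroup subgroup_closure] closure_group_eq by simp

sublocale E: group E
  by (rule group_closure)

section \<open>Fixed points, conjugates of the isotropy group, normal subgroups\<close>

lemma mult_closure: "(f \<otimes>\<^bsub>E\<^esub> h) u = f (h u)"
  if "f \<in> carrier E" "h \<in> carrier E" "u \<in> M"
proof -
  have "f \<otimes>\<^bsub>E\<^esub> h = f \<otimes>\<^bsub>B\<^esub> h"
    by (subst closure_group_eq) simp
  then show ?thesis
    using that by (simp add: mult_B mem_closure_iff compose_eq)
qed

lemma one_closure: "\<one>\<^bsub>E\<^esub> = (\<lambda>u\<in>M. u)"
  by (subst closure_group_eq) (simp add: BijGroup_def)

lemma inv_closure: "(inv\<^bsub>E\<^esub> f) (f u) = u" if "f \<in> carrier E" "u \<in> M"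
  using mult_closure[of "inv\<^bsub>E\<^esub> f" f u] that by (simp add: one_closure)

text \<open>Two continuous maps into a Hausdorff space that agree on a set agree on its closure.
  Here the maps are \<open>f\<close> and the identity, and the set is the orbit of \<open>x\<close>,
  dense by minimality.\<close>

lemma closure_eq_one:
  assumes f: "f \<in> carrier E" and x: "x \<in> M"
    and fix_orbit: "\<And>k. k \<in> carrier G \<Longrightarrow> f (\<phi> k x) = \<phi> k x"
  shows "f = \<one>\<^bsub>E\<^esub>"
\<comment> \<open>Both maps take the default value outside \<open>M\<close>, so agreement on
  \<open>M\<close> is equality.\<close>
proof (rule extensionalityI[of _ M])
  show "f \<in> extensional M"
    using f by (simp add: mem_closure_iff Bij_imp_extensional)
  show "\<one>\<^bsub>E\<^esub> \<in> extensional M"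
    by (simp add: one_closure)
  fix u
  assume u: "u \<in> M"
  have "f u = id u"
  proof (rule forall_in_closure_of_eq[where f = f and g = id])
    show "u \<in> mtopology_of m closure_of orbit G \<phi> x"
      using minimal[OF x] u by simp
    show "Hausdorff_space (mtopology_of m)"
      by (simp add: mtopology_of_def ms.Hausdorff_space_mtopology)
    show "continuous_map (mtopology_of m) (mtopology_of m) f"
      using f mem_closure_iff homeomorphic_imp_continuous_map by blast
  qed (use fix_orbit in \<open>auto simp: orbit_def\<close>)
  then show "f u = \<one>\<^bsub>E\<^esub> u"
    using u by (simp add: one_closure)
qed

text \<open>Conjugation moves the base point: \<open>h\<close> fixes \<open>x\<close> exactly when
  its conjugate by \<open>\<phi> k\<close> fixes \<open>\<phi> k x\<close>.\<close>

lemma mem_conjugate_isotropy: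
  assumes k: "k \<in> carrier G" and x: "x \<in> M"
  shows "f \<in> \<phi> k <#\<^bsub>E\<^esub> isotropy m G \<phi> x #>\<^bsub>E\<^esub> inv\<^bsub>E\<^esub> (\<phi> k) \<longleftrightarrow>
    f \<in> carrier E \<and> f (\<phi> k x) = \<phi> k x"
proof -
  have K: "\<phi> k \<in> carrier E"
    using act_in_closure k .
  have kx: "\<phi> k x \<in> M"
    using act_closed k x .
  show ?thesis
  proof
    assume "f \<in> \<phi> k <#\<^bsub>E\<^esub> isotropy m G \<phi> x #>\<^bsub>E\<^esub> inv\<^bsub>E\<^esub> (\<phi> k)"
    then obtain h where h: "h \<in> carrier E" "h x = x" "f = \<phi> k \<otimes>\<^bsub>E\<^esub> h \<otimes>\<^bsub>E\<^esub> inv\<^bsub>E\<^esub> (\<phi> k)"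
      by (auto simp: l_coset_def r_coset_def isotropy_def)
    then show "f \<in> carrier E \<and> f (\<phi> k x) = \<phi> k x"
      using K kx x by (simp add: mult_closure inv_closure)
  next
    assume f: "f \<in> carrier E \<and> f (\<phi> k x) = \<phi> k x"
    define h where "h = inv\<^bsub>E\<^esub> (\<phi> k) \<otimes>\<^bsub>E\<^esub> f \<otimes>\<^bsub>E\<^esub> \<phi> k"
    have "h \<in> isotropy m G \<phi> x"
      using f K kx x by (simp add: h_def isotropy_def mult_closure inv_closure)
    moreover have "f = \<phi> k \<otimes>\<^bsub>E\<^esub> h \<otimes>\<^bsub>E\<^esub> inv\<^bsub>E\<^esub> (\<phi> k)"
      \<comment> \<open>Associating to the right cancels the last pair of inverse factors,
        associating to the left the first pair.\<close>
      using f K by (simp add: h_def E.m_assoc) (simp flip: E.m_assoc)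
    ultimately show "f \<in> \<phi> k <#\<^bsub>E\<^esub> isotropy m G \<phi> x #>\<^bsub>E\<^esub> inv\<^bsub>E\<^esub> (\<phi> k)"
      by (auto simp: l_coset_def r_coset_def)
  qed
qed

lemma Inter_conjugate_isotropy:
  assumes x: "x \<in> M"
  shows "(\<Inter>k\<in>carrier G. \<phi> k <#\<^bsub>E\<^esub> isotropy m G \<phi> x #>\<^bsub>E\<^esub> inv\<^bsub>E\<^esub> (\<phi> k)) = {\<one>\<^bsub>E\<^esub>}"
proof -
  have "\<one>\<^bsub>E\<^esub> (\<phi> k x) = \<phi> k x" if "k \<in> carrier G" for k
    using act_closed[OF that x] by (simp add: one_closure)
  \<comment> \<open>Membership of \<open>f\<close> in \<open>carrier E\<close> is available only for
    a given \<open>k\<close>; the identity of \<open>G\<close> supplies one.\<close>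
  moreover have "f = \<one>\<^bsub>E\<^esub>" if "\<And>k. k \<in> carrier G \<Longrightarrow> f \<in> carrier E \<and> f (\<phi> k x) = \<phi> k x" for f
    using closure_eq_one[OF _ x, of f] that one_closed by blast
  ultimately show ?thesis
    by (auto simp: mem_conjugate_isotropy[OF _ x])
qed

lemma normal_isotropy_trivial:
  assumes x: "x \<in> M" and N: "N \<lhd> E" "N \<subseteq> isotropy m G \<phi> x"
  shows "N = {\<one>\<^bsub>E\<^esub>}"
proof -
  interpret N: normal N E
    by (rule N(1))
  have "f = \<one>\<^bsub>E\<^esub>" if f: "f \<in> N" for f
  proof (rule closure_eq_one[OF _ x])
    show fE: "f \<in> carrier E"
      using f N.subset by blast
    fix k
    assume k: "k \<in> carrier G"
    have K: "\<phi> k \<in> carrier E"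
      using act_in_closure k .
    \<comment> \<open>Normality keeps this conjugate of \<open>f\<close> inside \<open>N\<close>, so
      it fixes \<open>x\<close>; multiplying by \<open>\<phi> k\<close> on the left shows that
      \<open>f\<close> fixes \<open>\<phi> k x\<close>.\<close>
    then have "inv\<^bsub>E\<^esub> (\<phi> k) \<otimes>\<^bsub>E\<^esub> f \<otimes>\<^bsub>E\<^esub> \<phi> k \<in> isotropy m G \<phi> x"
      using N.inv_op_closed1 f N(2) by blast
    then have *: "(\<phi> k \<otimes>\<^bsub>E\<^esub> (inv\<^bsub>E\<^esub> (\<phi> k) \<otimes>\<^bsub>E\<^esub> f \<otimes>\<^bsub>E\<^esub> \<phi> k)) x = \<phi> k x"
      using K fE x by (simp add: mult_closure isotropy_def)
    have "\<phi> k \<otimes>\<^bsub>E\<^esub> (inv\<^bsub>E\<^esub> (\<phi> k) \<otimes>\<^bsub>E\<^esub> f \<otimes>\<^bsub>E\<^esub> \<phi> k) = f \<otimes>\<^bsub>E\<^esub> \<phi> k"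
      using K fE by (simp flip: E.m_assoc)
    then show "f (\<phi> k x) = \<phi> k x"
      using * mult_closure[OF fE K x] by simp
  qed
  then show ?thesis
    using N.one_closed by blast
qed

lemma subgroup_isotropy: "subgroup (isotropy m G \<phi> x) E" if x: "x \<in> M"
proof (rule E.subgroupI)
  show "isotropy m G \<phi> x \<noteq> {}"
    using x by (auto simp: isotropy_def one_closure intro!: exI[of _ "\<one>\<^bsub>E\<^esub>"])
  show "inv\<^bsub>E\<^esub> f \<in> isotropy m G \<phi> x" if "f \<in> isotropy m G \<phi> x" for f
    using that x inv_closure[of f x] by (auto simp: isotropy_def)
qed (use x in \<open>auto simp: isotropy_def mult_closure\<close>)

text \<open>The equivalence gives existence and uniqueness together: every candidate is trivial, and
  the trivial subgroup is a candidate.\<close>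

lemma is_maximal_normal_subgroup_in_isotropy_iff:
  assumes x: "x \<in> M"
  shows "is_maximal_normal_subgroup_in N (isotropy m G \<phi> x) E \<longleftrightarrow> N = {\<one>\<^bsub>E\<^esub>}"
proof -
  let ?H = "isotropy m G \<phi> x"
  have trivial: "N' = {\<one>\<^bsub>E\<^esub>}" if "subgroup N' (E\<lparr>carrier := ?H\<rparr>)" "N' \<lhd> E" for N'
    using normal_isotropy_trivial[OF x that(2)] subgroup.subset[OF that(1)] by simp
  \<comment> \<open>The definition asks for a subgroup of the isotropy group as a group in its own
    right. Its unit is that of \<open>E\<close>, so its trivial subgroup is the same set.\<close>
  have "group (E\<lparr>carrier := ?H\<rparr>)"
    by (rule E.subgroup_imp_group[OF subgroup_isotropy[OF x]])
  then have "subgroup {\<one>\<^bsub>E\<^esub>} (E\<lparr>carrier := ?H\<rparr>)"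
    using group.triv_subgroup by fastforce
  then show ?thesis
    unfolding is_maximal_normal_subgroup_in_def using trivial E.one_is_normal by blast
qed

end

theorem theorem1p10:
  fixes m :: "'a metric" and G :: "('g, 'b) monoid_scheme"
    and \<phi> :: "'g \<Rightarrow> 'a \<Rightarrow> 'a" and x :: 'a
  assumes "equicontinuous_cantor_minimal_system m G \<phi>"
    and "x \<in> mspace m"
  shows "let E = closure_group m G \<phi>; H = isotropy m G \<phi> x in
      (\<Inter>k\<in>carrier G. \<phi> k <#\<^bsub>E\<^esub> H #>\<^bsub>E\<^esub> inv\<^bsub>E\<^esub> (\<phi> k)) = {\<one>\<^bsub>E\<^esub>} \<and>
      (\<forall>N. is_maximal_normal_subgroup_in N H E \<longleftrightarrow> N = {\<one>\<^bsub>E\<^esub>})"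
proof -
  interpret equicontinuous_cantor_minimal_system m G \<phi>
    by (rule assms(1))
  show ?thesis
    unfolding Let_def
    using Inter_conjugate_isotropy is_maximal_normal_subgroup_in_isotropy_iff assms(2) by blast
qed

end
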